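(* Let $n\ge3$, let $\lambda_5,\lambda_7,\dots,\lambda_{2n-1}\in\mathbb{C}$, and let $\varphi$ be a $\frac12$-derivation of the Lie algebra $\mathfrak{r}_{2n+1}(\lambda_5,\dots,\lambda_{2n-1})$. Then there are complex numbers $a,b,c$ such that $$\varphi(e_i)=ae_i\ (1\le i\le 2n,\ i\neq2),\quad \varphi(e_2)=ae_2+be_{2n},\quad \varphi(x)=ce_{2n}+ax.$$
   Context: All algebras are over $\mathbb{C}$. A $\frac12$-derivation of a Lie algebra $(\mathfrak{L},[-,-])$ is a linear map $\varphi:\mathfrak{L}\to\mathfrak{L}$ with $\varphi([u,v])=\frac12([\varphi(u),v]+[u,\varphi(v)])$ for all $u,v\in\mathfrak{L}$. $\mathfrak{r}_{2n+1}(\lambda_5,\dots,\lambda_{2n-1})$ (parameters $\lambda_{2k+1}$, $2\le k\le n-1$) is the $(2n+1)$-dimensional Lie algebra with basis $e_1,\dots,e_{2n},x$ and brackets $[e_i,e_1]=e_{i+1}$ for $2\le i\le 2n-2$; $[e_i,e_{2n+1-i}]=(-1)^ie_{2n}$ for $2\le i\le n$; $[e_{2+i},x]=e_{2+i}+\sum_{k=2}^{\lfloor (2n-2-i)/2\rfloor}\lambda_{2k+1}e_{2k+1+i}$ for $0\le i\le 2n-6$; $[e_{2n-i},x]=e_{2n-i}$ for $i=1,2,3$; $[e_{2n},x]=2e_{2n}$; brackets of basis elements not determined by these and antisymmetry are zero. *)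

theory Defs
  imports Complex_Main
begin

text \<open>Complex Lie algebras. Complex scalar multiplication on a vector space has no type class
  in the library, so it is a parameter of the library locale \<^locale>\<open>vector_space\<close>.\<close>

locale lie_algebra = vector_space scale
  for scale :: "complex \<Rightarrow> 'v::ab_group_add \<Rightarrow> 'v" +
  fixes br :: "'v \<Rightarrow> 'v \<Rightarrow> 'v"
  assumes br_linear_left: "\<And>v. Vector_Spaces.linear scale scale (\<lambda>u. br u v)"
    and br_linear_right: "\<And>u. Vector_Spaces.linear scale scale (\<lambda>v. br u v)"
    and br_alternating: "\<And>u. br u u = 0"
    and br_jacobi: "\<And>u v w. br u (br v w) + br v (br w u) + br w (br u v) = 0"

definition half_derivation ::
    "(complex \<Rightarrow> 'v::ab_group_add \<Rightarrow> 'v) \<Rightarrow> ('v \<Rightarrow> 'v \<Rightarrow> 'v) \<Rightarrow> ('v \<Rightarrow> 'v) \<Rightarrow> bool" where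
  "half_derivation scale br \<phi> \<longleftrightarrow>
     Vector_Spaces.linear scale scale \<phi> \<and>
     (\<forall>u v. \<phi> (br u v) = scale (1 / 2) (br (\<phi> u) v + br u (\<phi> v)))"

text \<open>The Lie algebra \<open>r\<^bsub>2n+1\<^esub>(\<lambda>\<^sub>5, \<lambda>\<^sub>7, \<dots>, \<lambda>\<^bsub>2n-1\<^esub>)\<close>, for \<open>n \<ge> 3\<close>, together with its defining
  basis \<open>e 1, \<dots>, e (2n), x\<close>. Only the values \<open>lam 5, lam 7, \<dots>, lam (2n-1)\<close> occur in the brackets,
  and \<open>e\<close> is constrained only on \<open>{1..2n}\<close>. For \<open>n \<ge> 3\<close> no subtraction below truncates.\<close>

locale r_algebra = lie_algebra scale br
  for scale :: "complex \<Rightarrow> 'v::ab_group_add \<Rightarrow> 'v" and br :: "'v \<Rightarrow> 'v \<Rightarrow> 'v" +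
  fixes n :: nat and lam :: "nat \<Rightarrow> complex" and e :: "nat \<Rightarrow> 'v" and x :: 'v
  assumes basis_distinct: "inj_on e {1..2*n}" "x \<notin> e ` {1..2*n}"
    and basis_independent: "independent (insert x (e ` {1..2*n}))"
    and basis_span: "span (insert x (e ` {1..2*n})) = UNIV"
    and br_e_e1: "\<And>i. 2 \<le> i \<Longrightarrow> i \<le> 2*n - 2 \<Longrightarrow> br (e i) (e 1) = e (i + 1)"
    and br_e_e: "\<And>i. 2 \<le> i \<Longrightarrow> i \<le> n \<Longrightarrow>
      br (e i) (e (2*n + 1 - i)) = scale ((-1) ^ i) (e (2*n))"
    and br_e_x: "\<And>i. i \<le> 2*n - 6 \<Longrightarrow>
      br (e (2 + i)) x =
        e (2 + i) + (\<Sum>k = 2..(2*n - 2 - i) div 2. scale (lam (2*k + 1)) (e (2*k + 1 + i)))"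
    and br_e_x_top: "\<And>i. i \<in> {1, 2, 3} \<Longrightarrow> br (e (2*n - i)) x = e (2*n - i)"
    and br_e2n_x: "br (e (2*n)) x = scale 2 (e (2*n))"
    and br_e1_x: "br (e 1) x = 0"
    and br_e_e_zero: "\<And>i j. i \<in> {1..2*n} \<Longrightarrow> j \<in> {1..2*n} \<Longrightarrow>
      \<not> (2 \<le> i \<and> i \<le> 2*n - 2 \<and> j = 1) \<Longrightarrow> \<not> (2 \<le> j \<and> j \<le> 2*n - 2 \<and> i = 1) \<Longrightarrow>
      \<not> (2 \<le> i \<and> i \<le> n \<and> j = 2*n + 1 - i) \<Longrightarrow> \<not> (2 \<le> j \<and> j \<le> n \<and> i = 2*n + 1 - j) \<Longrightarrow>
      br (e i) (e j) = 0"

end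

theory Submission
  imports Defs
begin

text \<open>Subtract \<open>\<xi> id\<close> from \<open>\<phi>\<close>, where \<open>\<xi>\<close> is the \<open>x\<close>-coordinate of \<open>\<phi> x\<close>; the identity
  is a half-derivation, so the difference \<open>\<psi>\<close> is one too. The operator \<open>R = [-, x]\<close> is triangular in
  the basis \<open>x, e 1, \<dots>, e (2n)\<close> with diagonal \<open>0, 0, 1, \<dots>, 1, 2\<close>, and this triangularity is the
  only information about the parameters \<open>lam\<close> that is needed. As \<open>4 - R\<close> is invertible,
  \<open>\<psi> (e (2n)) = 0\<close>; as \<open>2 - R\<close> is singular only along \<open>e (2n)\<close>, downward induction on \<open>j\<close> determines
  \<open>\<psi> (e j)\<close> modulo \<open>e (2n)\<close> as soon as \<open>[e j, \<psi> x]\<close> is known. Evaluating \<open>\<psi>\<close> at \<open>e 3 = [e 2, e 1]\<close>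
  then kills the \<open>x\<close>- and \<open>e 1\<close>-coordinates of \<open>\<psi> (e 1)\<close> and \<open>\<psi> x\<close>. Finally, the relations
  \<open>2 \<psi> (e (j+1)) = [e j, \<psi> (e 1)]\<close>, \<open>2 \<psi> ((R - 1) (e j)) = [e j, \<psi> x]\<close> and
  \<open>R (\<psi> (e 1)) = [\<psi> x, e 1]\<close> push \<open>\<psi> (e 1)\<close> ever deeper into the filtration, until it vanishes.\<close>

section \<open>Coordinates and the filtration attached to the ordered basis\<close>

context r_algebra
begin

text \<open>Index 0 for \<open>x\<close> turns \<open>x, e 1, ..., e (2*n)\<close> into one
  sequence, and triangularity refers to this order.\<close>

definition bas :: "nat \<Rightarrow> 'v" where
  "bas i = (if i = 0 then x else e i)"

definition coord :: "nat \<Rightarrow> 'v \<Rightarrow> complex" where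
  "coord i v = representation (insert x (e ` {1..2*n})) v (bas i)"

text \<open>This is the span of the \<open>bas i\<close> with \<open>m \<le> i\<close>, so it is
  zero for \<open>m = Suc (2*n)\<close> and the line of \<open>e (2*n)\<close> for
  \<open>m = 2*n\<close>. The bound \<open>i \<le> 2*n\<close> is there because larger indices name
  no basis vector.\<close>

definition filt :: "nat \<Rightarrow> 'v set" where
  "filt m = {v. \<forall>i<m. i \<le> 2*n \<longrightarrow> coord i v = 0}"

definition weight :: "nat \<Rightarrow> complex" where
  "weight i = (if i < 2 then 0 else if i < 2*n then 1 else 2)"

lemma bas_image: "bas ` {..2*n} = insert x (e ` {1..2*n})"
proof -
  have "{..2*n} = insert 0 {1..2*n}" by auto
  then show ?thesis by (auto simp: bas_def)
qed

lemma inj_on_bas: "inj_on bas {..2*n}"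
proof (rule inj_onI)
  fix i j assume *: "i \<in> {..2*n}" "j \<in> {..2*n}" "bas i = bas j"
  have x: "x \<noteq> e k" if "1 \<le> k" "k \<le> 2*n" for k
    using basis_distinct(2) that by auto
  show "i = j"
  proof (cases "i = 0 \<or> j = 0")
    case True
    then show ?thesis using * x[of i] x[of j] by (auto simp: bas_def split: if_splits)
  next
    case False
    then show ?thesis using * inj_onD[OF basis_distinct(1), of i j] by (simp add: bas_def)
  qed
qed

lemma coord_add: "coord i (u + v) = coord i u + coord i v"
  unfolding coord_def using basis_independent basis_span
  by (subst representation_add) auto

lemma coord_scale: "coord i (scale c v) = c * coord i v"
  unfolding coord_def using basis_independent basis_span
  by (subst representation_scale) auto

lemma coord_zero [simp]: "coord i 0 = 0"
  using coord_scale[of i 0 0] by simp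

lemma coord_uminus: "coord i (- v) = - coord i v"
  using coord_scale[of i "-1" v] by simp

lemma coord_diff: "coord i (u - v) = coord i u - coord i v"
  using coord_add[of i u "- v"] by (simp add: coord_uminus)

lemma coord_bas: "i \<le> 2*n \<Longrightarrow> j \<le> 2*n \<Longrightarrow> coord i (bas j) = (if i = j then 1 else 0)"
proof -
  assume *: "i \<le> 2*n" "j \<le> 2*n"
  then have "bas j \<in> insert x (e ` {1..2*n})" by (subst bas_image[symmetric]) auto
  then have "coord i (bas j) = (if bas j = bas i then 1 else 0)"
    unfolding coord_def using representation_basis[OF basis_independent] by auto
  then show ?thesis using inj_on_bas * by (auto simp: inj_on_eq_iff)
qed

lemma coord_expansion: "v = (\<Sum>i\<le>2*n. scale (coord i v) (bas i))"
proof -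
  have "v = (\<Sum>b\<in>bas ` {..2*n}. scale (representation (insert x (e ` {1..2*n})) v b) b)"
    unfolding bas_image
    by (rule sum_representation_eq[symmetric])
       (use basis_independent basis_span in auto)
  also have "\<dots> = (\<Sum>i\<le>2*n. scale (coord i v) (bas i))"
    by (simp add: sum.reindex[OF inj_on_bas] coord_def)
  finally show ?thesis .
qed

lemma filt_zero [simp]: "0 \<in> filt m" by (simp add: filt_def)

lemma filt_add: "u \<in> filt m \<Longrightarrow> v \<in> filt m \<Longrightarrow> u + v \<in> filt m"
  by (simp add: filt_def coord_add)

lemma filt_diff: "u \<in> filt m \<Longrightarrow> v \<in> filt m \<Longrightarrow> u - v \<in> filt m"
  by (simp add: filt_def coord_diff)

lemma filt_uminus: "v \<in> filt m \<Longrightarrow> - v \<in> filt m"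
  by (simp add: filt_def coord_uminus)

lemma filt_scale: "v \<in> filt m \<Longrightarrow> scale c v \<in> filt m"
  by (simp add: filt_def coord_scale)

lemma filt_sum: "(\<And>i. i \<in> A \<Longrightarrow> f i \<in> filt m) \<Longrightarrow> sum f A \<in> filt m"
  by (induction A rule: infinite_finite_induct) (auto intro: filt_add)

lemma filt_mono: "v \<in> filt m \<Longrightarrow> k \<le> m \<Longrightarrow> v \<in> filt k"
  by (simp add: filt_def)

lemma filt_0 [simp]: "v \<in> filt 0" by (simp add: filt_def)

lemma bas_in_filt: "m \<le> i \<Longrightarrow> i \<le> 2*n \<Longrightarrow> bas i \<in> filt m"
  by (simp add: filt_def coord_bas)

lemma filt_Suc: "v \<in> filt (Suc m) \<longleftrightarrow> v \<in> filt m \<and> (m \<le> 2*n \<longrightarrow> coord m v = 0)"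
  by (auto simp: filt_def less_Suc_eq)

lemma coord_filt: "v \<in> filt m \<Longrightarrow> i < m \<Longrightarrow> i \<le> 2*n \<Longrightarrow> coord i v = 0"
  by (simp add: filt_def)

lemma filt_split: "v \<in> filt m \<Longrightarrow> m \<le> 2*n \<Longrightarrow> v - scale (coord m v) (bas m) \<in> filt (Suc m)"
  by (auto simp: filt_def coord_diff coord_scale coord_bas less_Suc_eq)

lemma filt_top_zero: "v \<in> filt (Suc (2*n)) \<Longrightarrow> v = 0"
  using coord_expansion[of v] by (simp add: filt_def)

lemma filt_2n: "v \<in> filt (2*n) \<Longrightarrow> v = scale (coord (2*n) v) (bas (2*n))"
  using filt_top_zero[OF filt_split] by simp

lemma linear_filt:
  assumes L: "Vector_Spaces.linear scale scale L"
    and LE: "\<And>i. k \<le> i \<Longrightarrow> i \<le> 2*n \<Longrightarrow> L (bas i) \<in> filt m"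
    and v: "v \<in> filt k"
  shows "L v \<in> filt m"
proof -
  interpret L: Vector_Spaces.linear scale scale L by (rule L)
  have "L v = (\<Sum>i\<le>2*n. scale (coord i v) (L (bas i)))"
    by (subst coord_expansion[of v]) (simp add: L.sum L.scale)
  also have "\<dots> \<in> filt m"
  proof (rule filt_sum)
    fix i assume "i \<in> {..2*n}"
    then show "scale (coord i v) (L (bas i)) \<in> filt m"
      using v LE[of i] by (cases "i < k") (auto simp: filt_def coord_scale)
  qed
  finally show ?thesis .
qed

lemma br_add_left: "br (u + v) w = br u w + br v w"
  using br_linear_left[of w] by (simp add: Vector_Spaces.linear_iff)

lemma br_add_right: "br w (u + v) = br w u + br w v"
  using br_linear_right[of w] by (simp add: Vector_Spaces.linear_iff)

lemma br_scale_left: "br (scale c v) w = scale c (br v w)"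
  using br_linear_left[of w] by (simp add: Vector_Spaces.linear_iff)

lemma br_scale_right: "br w (scale c v) = scale c (br w v)"
  using br_linear_right[of w] by (simp add: Vector_Spaces.linear_iff)

lemma br_swap: "br u v = - br v u"
proof -
  have "br u v + br v u = br (u + v) (u + v)"
    unfolding br_add_left br_add_right by (simp add: br_alternating)
  then show ?thesis by (simp add: br_alternating eq_neg_iff_add_eq_0)
qed

lemma br_zero_right [simp]: "br u 0 = 0"
  using br_scale_right[of u 0 0] by simp

lemma half_derivation_diff_scale:
  assumes "half_derivation scale br \<phi>"
  shows "half_derivation scale br (\<lambda>v. \<phi> v - scale c v)"
proof -
  have L: "Vector_Spaces.linear scale scale \<phi>" and
    D: "\<And>u v. \<phi> (br u v) = scale (1 / 2) (br (\<phi> u) v + br u (\<phi> v))"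
    using assms by (auto simp: half_derivation_def)
  have "Vector_Spaces.linear scale scale (\<lambda>v. \<phi> v - scale c v)"
    using L by (simp add: Vector_Spaces.linear_iff algebra_simps)
  moreover have "\<phi> (br u v) - scale c (br u v) =
      scale (1 / 2) (br (\<phi> u - scale c u) v + br u (\<phi> v - scale c v))" for u v
  proof -
    have l: "br (\<phi> u - scale c u) v = br (\<phi> u) v - scale c (br u v)"
      using br_add_left[of "\<phi> u - scale c u" "scale c u" v] by (simp add: br_scale_left)
    have r: "br u (\<phi> v - scale c v) = br u (\<phi> v) - scale c (br u v)"
      using br_add_right[of u "\<phi> v - scale c v" "scale c v"] by (simp add: br_scale_right)
    have h: "scale (1 / 2) (y - w + (z - w)) = scale (1 / 2) (y + z) - w" for y z w
    proof -
      have "w + w = scale 2 w" using scale_left_distrib[of 1 1 w] by simp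
      then have "y - w + (z - w) = y + z - scale 2 w" by (simp add: algebra_simps)
      then have "scale (1 / 2) (y - w + (z - w)) = scale (1 / 2) (y + z - scale 2 w)" by simp
      also have "\<dots> = scale (1 / 2) (y + z) - w" by (simp only: scale_right_diff_distrib) simp
      finally show ?thesis .
    qed
    show ?thesis by (simp only: l r D h)
  qed
  ultimately show ?thesis by (simp add: half_derivation_def)
qed

end

section \<open>Brackets with \<open>x\<close>, \<open>e 1\<close> and the other basis vectors on the
  filtration\<close>

locale r_algebra_ge_3 = r_algebra +
  assumes n3: "n \<ge> 3"
begin

declare One_nat_def [simp del]

text \<open>The parameter sum in the bracket of \<open>e k\<close> with \<open>x\<close> starts at
  summation index 2, hence at \<open>e (k + 3)\<close>, strictly beyond the diagonal.\<close>

lemma br_bas_x: 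
  assumes "k \<le> 2*n"
  shows "br (bas k) x - scale (weight k) (bas k) \<in> filt (Suc k)"
proof -
  consider "k = 0" | "k = 1" | "2 \<le> k" "k \<le> 2*n - 4" | "2*n - 3 \<le> k" "k < 2*n" | "k = 2*n"
    using assms n3 by linarith
  then show ?thesis
  proof cases
    case 3
    have k: "2 + (k-2) = k" "k < 2*n" using 3 n3 by auto
    have "br (e (2 + (k-2))) x =
        e (2 + (k-2)) + (\<Sum>j = 2..(2*n - 2 - (k-2)) div 2. scale (lam (2*j + 1)) (e (2*j + 1 + (k-2))))"
      by (rule br_e_x) (use 3 in simp)
    then have "br (bas k) x - scale (weight k) (bas k) =
       (\<Sum>j = 2..(2*n - 2 - (k-2)) div 2. scale (lam (2*j + 1)) (bas (2*j + 1 + (k-2))))"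
      unfolding k(1) using 3 k(2) by (simp add: bas_def weight_def)
    also have "\<dots> \<in> filt (Suc k)"
      by (intro filt_sum filt_scale bas_in_filt) (use 3 in auto)
    finally show ?thesis .
  next
    case 4
    then have "2*n - k \<in> {1, 2, 3}" and k2: "k \<ge> 2" using n3 by auto
    then show ?thesis using br_e_x_top[of "2*n - k"] 4 k2 by (simp add: bas_def weight_def)
  qed (use n3 br_e1_x br_e2n_x br_alternating in \<open>auto simp: bas_def weight_def\<close>)
qed

lemma br_x_filt: "v \<in> filt k \<Longrightarrow> br v x \<in> filt k"
proof (rule linear_filt[OF br_linear_left])
  fix i assume i: "k \<le> i" "i \<le> 2*n"
  have "(br (bas i) x - scale (weight i) (bas i)) + scale (weight i) (bas i) \<in> filt k"
    by (intro filt_add filt_scale bas_in_filt filt_mono[OF br_bas_x]) (use i in auto)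
  then show "br (bas i) x \<in> filt k" by simp
qed

lemma coord_br_x:
  assumes "v \<in> filt k" "k \<le> 2*n"
  shows "coord k (br v x) = weight k * coord k v"
proof -
  let ?w = "v - scale (coord k v) (bas k)"
  have w: "coord k (br ?w x) = 0"
    using coord_filt[OF br_x_filt[OF filt_split[OF assms]]] assms(2) by simp
  have "coord k (br (bas k) x) = weight k"
    using coord_filt[OF br_bas_x[OF assms(2)]] assms(2) by (simp add: coord_diff coord_scale coord_bas)
  moreover have "br v x = br ?w x + scale (coord k v) (br (bas k) x)"
    using br_add_left[of ?w "scale (coord k v) (bas k)"] by (simp add: br_scale_left)
  ultimately show ?thesis using w by (simp add: coord_add coord_scale)
qed

text \<open>On \<open>filt k\<close> modulo \<open>filt (Suc k)\<close>, the operator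
  \<open>\<mu> - R\<close> is the scalar \<open>\<mu> - weight k\<close>. Where it is nonzero,
  coordinate \<open>k\<close> of \<open>w\<close> must vanish, and the coordinates are cleared one
  after the other. The values used are \<mu> = 4, 2 and 0.\<close>

lemma filt_of_br_x:
  assumes "w \<in> filt l" "scale \<mu> w - br w x \<in> filt m" "\<And>i. l \<le> i \<Longrightarrow> i < m \<Longrightarrow> i \<le> 2*n \<Longrightarrow> \<mu> \<noteq> weight i" "l \<le> m"
  shows "w \<in> filt m"
proof -
  have "w \<in> filt k" if "l \<le> k" "k \<le> m" for k
    using that
  proof (induction k rule: dec_induct)
    case base
    then show ?case using assms by simp
  next
    case (step k)
    show ?case unfolding filt_Suc
    proof (intro conjI impI)
      show "w \<in> filt k" using step by simp
      assume k: "k \<le> 2*n"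
      have "coord k (scale \<mu> w - br w x) = 0" using coord_filt[OF assms(2)] step k by simp
      then have "(\<mu> - weight k) * coord k w = 0"
        using step coord_br_x k by (simp add: coord_diff coord_scale algebra_simps)
      then show "coord k w = 0" using assms(3) step k by simp
    qed
  qed
  then show ?thesis using assms by blast
qed

lemma br_bas_e1: "2 \<le> i \<Longrightarrow> i \<le> 2*n - 2 \<Longrightarrow> br (bas i) (e 1) = bas (Suc i)"
  using br_e_e1[of i] by (simp add: bas_def Suc_eq_plus1)

lemma br_bas_e1_top: "2*n - 1 \<le> i \<Longrightarrow> i \<le> 2*n \<Longrightarrow> br (bas i) (e 1) = 0"
proof -
  assume i: "2*n - 1 \<le> i" "i \<le> 2*n"
  have "br (e i) (e 1) = 0"
    by (rule br_e_e_zero) (use i n3 in auto)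
  moreover have "i > 0" using i n3 by simp
  ultimately show ?thesis by (simp add: bas_def)
qed

lemma br_e1_filt: "v \<in> filt k \<Longrightarrow> 2 \<le> k \<Longrightarrow> br v (e 1) \<in> filt (Suc k)"
proof (rule linear_filt[OF br_linear_left])
  fix i assume i: "2 \<le> k" "k \<le> i" "i \<le> 2*n"
  show "br (bas i) (e 1) \<in> filt (Suc k)"
    using i br_bas_e1[of i] br_bas_e1_top[of i] n3 by (cases "i \<le> 2*n - 2") (auto intro: bas_in_filt)
qed

lemma coord_br_e1:
  assumes "v \<in> filt k" "2 \<le> k" "k \<le> 2*n - 2"
  shows "coord (Suc k) (br v (e 1)) = coord k v"
proof -
  let ?w = "v - scale (coord k v) (bas k)"
  have k: "k \<le> 2*n" "Suc k \<le> 2*n" using assms n3 by auto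
  have w: "coord (Suc k) (br ?w (e 1)) = 0"
    using coord_filt[OF br_e1_filt[OF filt_split[OF assms(1)]]] assms(2) k by simp
  moreover have "br v (e 1) = br ?w (e 1) + scale (coord k v) (br (bas k) (e 1))"
    using br_add_left[of ?w "scale (coord k v) (bas k)"] by (simp add: br_scale_left)
  ultimately show ?thesis using assms k by (simp add: coord_add coord_scale br_bas_e1 coord_bas)
qed

lemma br_bas_bas_zero:
  assumes "2 \<le> i" "2 \<le> j" "i \<le> 2*n" "j \<le> 2*n" "i + j \<noteq> 2*n + 1"
  shows "br (bas i) (bas j) = 0"
proof -
  have "br (e i) (e j) = 0"
    by (rule br_e_e_zero) (use assms in auto)
  then show ?thesis using assms by (simp add: bas_def)
qed

text \<open>The sign depends on which of the two indices is at most \<open>n\<close>. Only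
  \<open>s \<noteq> 0\<close> matters: the bracket pairs the span of
  \<open>e 2, ..., e (2*n - 1)\<close> with itself perfectly, with values in the line of
  \<open>e (2*n)\<close>.\<close>

lemma br_bas_bas_dual:
  assumes "2 \<le> i" "i + j = 2*n + 1" "2 \<le> j"
  obtains s where "s \<noteq> 0" "br (bas i) (bas j) = scale s (bas (2*n))"
proof (cases "i \<le> n")
  case True
  have "br (e i) (e (2*n + 1 - i)) = scale ((-1)^i) (e (2*n))"
    using True assms br_e_e by blast
  moreover have "2*n + 1 - i = j" using assms by simp
  ultimately show ?thesis using that[of "(-1)^i"] assms n3 by (simp add: bas_def)
next
  case False
  have "br (e j) (e (2*n + 1 - j)) = scale ((-1)^j) (e (2*n))"
    using False assms br_e_e[of j] by simp
  moreover have "2*n + 1 - j = i" using assms by simp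
  ultimately have "br (bas i) (bas j) = scale (- ((-1)^j)) (bas (2*n))"
    using assms n3 br_swap[of "e i" "e j"] by (simp add: bas_def)
  then show ?thesis using that[of "- ((-1)^j)"] by simp
qed

lemma br_bas_filt: "v \<in> filt 2 \<Longrightarrow> 2 \<le> i \<Longrightarrow> i \<le> 2*n \<Longrightarrow> br (bas i) v \<in> filt (2*n)"
proof (rule linear_filt[OF br_linear_right])
  fix j assume j: "2 \<le> i" "i \<le> 2*n" "2 \<le> j" "j \<le> 2*n"
  show "br (bas i) (bas j) \<in> filt (2*n)"
  proof (cases "i + j = 2*n + 1")
    case True
    then obtain s where "br (bas i) (bas j) = scale s (bas (2*n))"
      using br_bas_bas_dual[of i j] j by blast
    then show ?thesis by (simp add: filt_scale bas_in_filt)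
  qed (use br_bas_bas_zero j in simp)
qed

text \<open>The only partner of \<open>bas i\<close> under this pairing has index
  \<open>2*n + 1 - i\<close>, which is below \<open>k\<close>.\<close>

lemma br_bas_filt_zero: "v \<in> filt k \<Longrightarrow> 2 \<le> k \<Longrightarrow> 2 \<le> i \<Longrightarrow> i \<le> 2*n \<Longrightarrow> 2*n + 1 < i + k \<Longrightarrow> br (bas i) v = 0"
  by (rule filt_top_zero, rule linear_filt[OF br_linear_right]) (use br_bas_bas_zero in auto)

text \<open>Bracketing with the partner of \<open>bas k\<close> detects the leading coordinate of
  \<open>v\<close>, since everything beyond \<open>bas k\<close> is annihilated.\<close>

lemma coord_zero_of_br_bas:
  assumes "v \<in> filt k" "2 \<le> k" "k \<le> 2*n - 1" "br (bas (2*n + 1 - k)) v = 0"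
  shows "coord k v = 0"
proof -
  let ?i = "2*n + 1 - k" and ?w = "v - scale (coord k v) (bas k)"
  obtain s where s: "s \<noteq> 0" "br (bas ?i) (bas k) = scale s (bas (2*n))"
    by (rule br_bas_bas_dual[of ?i k]) (use assms in auto)
  have "br (bas ?i) ?w = 0"
    by (rule br_bas_filt_zero[OF filt_split[OF assms(1)]]) (use assms in auto)
  moreover have "br (bas ?i) v = br (bas ?i) ?w + scale (coord k v) (br (bas ?i) (bas k))"
    using br_add_right[of "bas ?i" ?w "scale (coord k v) (bas k)"] by (simp add: br_scale_right)
  ultimately have "scale (coord k v) (scale s (bas (2*n))) = 0"
    using assms(4) s(2) by simp
  then have "coord (2*n) (scale (coord k v) (scale s (bas (2*n)))) = 0"
    by (simp only: coord_zero)
  then show ?thesis using s by (simp add: coord_scale coord_bas)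
qed

section \<open>Half-derivations \<psi> for which \<psi> x has no \<open>x\<close>-coordinate\<close>

lemma normalized_half_derivation:
  assumes hd: "half_derivation scale br \<psi>" and c0: "coord 0 (\<psi> x) = 0"
  shows "\<psi> (e 1) = 0" "\<And>i. 3 \<le> i \<Longrightarrow> i \<le> 2*n \<Longrightarrow> \<psi> (e i) = 0"
    "\<psi> (e 2) \<in> filt (2*n)" "\<psi> x \<in> filt (2*n)"
proof -
  have L: "Vector_Spaces.linear scale scale \<psi>"
    using hd by (simp add: half_derivation_def)
  interpret L: Vector_Spaces.linear scale scale \<psi> by (rule L)
  have D: "scale 2 (\<psi> (br u v)) = br (\<psi> u) v + br u (\<psi> v)" for u v
    using hd by (simp add: half_derivation_def)
  have bas_1: "bas 1 = e 1" by (simp add: bas_def)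
  \<comment> \<open>Here \<xi> is the \<open>e 1\<close>-coordinate of \<psi> x. It and \<alpha>0,
    \<alpha>1 are the coordinates to be shown zero; \<open>p\<close> and \<open>q\<close> are the
    remainders in \<open>filt 2\<close>.\<close>
  define \<xi> where "\<xi> = coord 1 (\<psi> x)"
  define \<alpha>0 where "\<alpha>0 = coord 0 (\<psi> (e 1))"
  define \<alpha>1 where "\<alpha>1 = coord 1 (\<psi> (e 1))"
  define p where "p = \<psi> x - scale \<xi> (e 1)"
  define q where "q = \<psi> (e 1) - scale \<alpha>0 x - scale \<alpha>1 (e 1)"
  have xF1: "\<psi> x \<in> filt 1" using c0 by (simp add: filt_def)
  have p: "p \<in> filt 2" "\<psi> x = scale \<xi> (e 1) + p"
    using filt_split[OF xF1] n3 by (auto simp: p_def \<xi>_def bas_1)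
  have q: "q \<in> filt 2" "\<psi> (e 1) = scale \<alpha>0 x + scale \<alpha>1 (e 1) + q"
  proof -
    have "\<psi> (e 1) - scale \<alpha>0 x \<in> filt 1"
      using filt_split[of "\<psi> (e 1)" 0] by (simp add: \<alpha>0_def bas_def One_nat_def)
    from filt_split[OF this]
    have "\<psi> (e 1) - scale \<alpha>0 x - scale (coord 1 (\<psi> (e 1) - scale \<alpha>0 x)) (e 1) \<in> filt 2"
      using n3 by (simp add: bas_1)
    moreover have "coord 1 (\<psi> (e 1) - scale \<alpha>0 x) = \<alpha>1"
      using coord_bas[of 1 0] n3 by (simp add: coord_diff coord_scale \<alpha>1_def bas_def)
    ultimately show "q \<in> filt 2" by (simp add: q_def)
  qed (simp add: q_def)

  \<comment> \<open>From \<open>R (e (2*n)) = 2 e (2*n)\<close> one gets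
    \<open>(4 - R) (\<psi> (e (2*n))) = [e (2*n), \<psi> x] = 0\<close>, and 4 is not a
    weight.\<close>
  have top: "\<psi> (bas (2*n)) = 0"
  proof -
    have "br (bas (2*n)) (\<psi> x) = 0"
      using br_bas_e1_top[of "2*n"] br_bas_filt_zero[OF p(1), of "2*n"] n3
      by (simp add: p(2) br_add_right br_scale_right)
    then have "scale 4 (\<psi> (bas (2*n))) - br (\<psi> (bas (2*n))) x \<in> filt (Suc (2*n))"
      using D[of "bas (2*n)" x] br_e2n_x n3 by (simp add: bas_def L.scale)
    then have "\<psi> (bas (2*n)) \<in> filt (Suc (2*n))"
      by (rule filt_of_br_x[OF filt_0]) (auto simp: weight_def)
    then show ?thesis by (rule filt_top_zero)
  qed

  \<comment> \<open>The half-derivation identity at \<open>bas j\<close> and \<open>x\<close>,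
    solved for \<open>(2 - R) (\<psi> (bas j))\<close>. For 2 \<le> j < 2n the last argument of
    \<psi> lies in \<open>filt (Suc j)\<close>, so downward induction on \<open>j\<close> controls
    that term.\<close>
  have key: "scale 2 (\<psi> (bas j)) - br (\<psi> (bas j)) x =
      scale \<xi> (br (bas j) (e 1)) + br (bas j) p - scale 2 (\<psi> (br (bas j) x - bas j))" for j
  proof -
    have "scale 2 (\<psi> (br (bas j) x)) =
        br (\<psi> (bas j)) x + (scale \<xi> (br (bas j) (e 1)) + br (bas j) p)"
      unfolding D p(2) br_add_right br_scale_right ..
    then have "scale 2 (\<psi> (br (bas j) x - bas j)) =
        br (\<psi> (bas j)) x + (scale \<xi> (br (bas j) (e 1)) + br (bas j) p) - scale 2 (\<psi> (bas j))"
      by (simp only: L.diff scale_right_diff_distrib)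
    then show ?thesis by simp
  qed
  have g: "br (bas j) x - bas j \<in> filt (Suc j)" if "2 \<le> j" "j < 2*n" for j
    using br_bas_x[of j] that by (simp add: weight_def)
  have \<psi>filt: "\<psi> v \<in> filt m" if "v \<in> filt k" "\<And>i. k \<le> i \<Longrightarrow> i < 2*n \<Longrightarrow> \<psi> (bas i) \<in> filt m" for v k m
  proof (rule linear_filt[OF L _ that(1)])
    fix i assume "k \<le> i" "i \<le> 2*n"
    then show "\<psi> (bas i) \<in> filt m" using that(2)[of i] top by (cases "i = 2*n") auto
  qed

  \<comment> \<open>The leading term of \<open>\<psi> (e j)\<close> is \<open>\<xi> e (j+1)\<close>:
    at position \<open>j + 1\<close> below \<open>2*n\<close> the operator \<open>2 - R\<close> is
    1, and only \<open>\<xi> [e j, e 1]\<close> contributes on the right of \<open>key\<close>.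
    Position \<open>2*n\<close> is left out, as \<open>2 - R\<close> is singular there.\<close>
  have B: "\<psi> (bas j) \<in> filt (Suc j) \<and> (Suc j < 2*n \<longrightarrow> coord (Suc j) (\<psi> (bas j)) = \<xi>)"
    if "2 \<le> j" "j < 2*n" for j
    using that(2,1)
  proof (induction j rule: measure_induct_rule[of "\<lambda>j. 2*n - j"])
    case (less j)
    have *: "\<psi> (br (bas j) x - bas j) \<in> filt (Suc (Suc j))"
    proof (rule \<psi>filt[OF g])
      fix i assume i: "Suc j \<le> i" "i < 2*n"
      then have "\<psi> (bas i) \<in> filt (Suc i)" using less.IH[of i] less.prems by auto
      then show "\<psi> (bas i) \<in> filt (Suc (Suc j))" by (rule filt_mono) (use i in simp)
    qed (use less.prems in auto)
    have W: "br (bas j) p \<in> filt (2*n)" using br_bas_filt[OF p(1)] less.prems by simp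
    have "scale 2 (\<psi> (bas j)) - br (\<psi> (bas j)) x \<in> filt (Suc j)"
      unfolding key
      by (intro filt_diff filt_add filt_scale br_e1_filt bas_in_filt filt_mono[OF W] filt_mono[OF *]) (use less.prems in auto)
    then have 1: "\<psi> (bas j) \<in> filt (Suc j)"
      by (rule filt_of_br_x[OF filt_0]) (use less.prems in \<open>auto simp: weight_def\<close>)
    moreover have "coord (Suc j) (\<psi> (bas j)) = \<xi>" if j: "Suc j < 2*n"
    proof -
      have "coord (Suc j) (scale 2 (\<psi> (bas j)) - br (\<psi> (bas j)) x) = coord (Suc j) (\<psi> (bas j))"
        using coord_br_x[OF 1] j less.prems by (simp add: coord_diff coord_scale weight_def)
      moreover have "coord (Suc j) (scale \<xi> (br (bas j) (e 1)) + br (bas j) p - scale 2 (\<psi> (br (bas j) x - bas j))) = \<xi>"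
        using coord_filt[OF *, of "Suc j"] coord_filt[OF W, of "Suc j"] j less.prems br_bas_e1[of j]
        by (simp add: coord_diff coord_add coord_scale coord_bas)
      ultimately show ?thesis by (simp only: key)
    qed
    ultimately show ?case by blast
  qed

  \<comment> \<open>Coordinates 2, 3 and 4 of
    \<open>2 \<psi> (e 3) = [\<psi> (e 2), e 1] + [e 2, \<psi> (e 1)]\<close> give in turn \<alpha>0
    = 0, \<alpha>1 = 0 and 2\<xi> = \<xi>. As n \<ge> 3, coordinate 4 lies below \<open>2*n\<close>,
    where \<open>[e 2, q]\<close> has no part.\<close>
  have C: "\<alpha>0 = 0 \<and> \<alpha>1 = 0 \<and> \<xi> = 0"
  proof -
    have "scale 2 (\<psi> (bas 3)) = br (\<psi> (bas 2)) (e 1) + br (bas 2) (\<psi> (e 1))"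
      using D[of "bas 2" "e 1"] br_bas_e1[of 2] n3 by (simp add: numeral_3_eq_3)
    also have "br (bas 2) (\<psi> (e 1)) = scale \<alpha>0 (br (bas 2) x) + scale \<alpha>1 (bas 3) + br (bas 2) q"
      using br_bas_e1[of 2] n3 by (simp add: q(2) br_add_right br_scale_right numeral_3_eq_3)
    finally have eq: "scale 2 (\<psi> (bas 3)) =
      br (\<psi> (bas 2)) (e 1) + (scale \<alpha>0 (br (bas 2) x) + scale \<alpha>1 (bas 3) + br (bas 2) q)" .
    have ceq: "2 * coord i (\<psi> (bas 3)) =
      coord i (br (\<psi> (bas 2)) (e 1)) + (\<alpha>0 * coord i (br (bas 2) x) + \<alpha>1 * coord i (bas 3) + coord i (br (bas 2) q))" for i
      using arg_cong[OF eq, of "coord i"] by (simp add: coord_add coord_scale)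
    have B2: "\<psi> (bas 2) \<in> filt 3" "coord 3 (\<psi> (bas 2)) = \<xi>" using B[of 2] n3 by auto
    have B3: "\<psi> (bas 3) \<in> filt 4" "coord 4 (\<psi> (bas 3)) = \<xi>" using B[of 3] n3 by auto
    have T2: "br (\<psi> (bas 2)) (e 1) \<in> filt 4" using br_e1_filt[OF B2(1)] by simp
    have T2': "coord 4 (br (\<psi> (bas 2)) (e 1)) = \<xi>" using coord_br_e1[OF B2(1)] B2 n3 by simp
    have W: "br (bas 2) q \<in> filt (2*n)" using br_bas_filt[OF q(1)] n3 by simp
    have "coord 2 (br (bas 2) x) = 1"
      using coord_br_x[of "bas 2" 2] bas_in_filt[of 2 2] n3 by (simp add: weight_def coord_bas)
    then have a0: "\<alpha>0 = 0"
      using ceq[of 2] coord_filt[OF W, of 2] coord_filt[OF T2, of 2] coord_filt[OF B3(1), of 2] n3 by (simp add: coord_bas)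
    then have a1: "\<alpha>1 = 0"
      using ceq[of 3] coord_filt[OF W, of 3] coord_filt[OF T2, of 3] coord_filt[OF B3(1), of 3] n3 by (simp add: coord_bas)
    have "\<xi> = 0"
      using ceq[of 4] coord_filt[OF W, of 4] T2' B3 n3 a0 a1 by simp
    then show ?thesis using a0 a1 by simp
  qed
  have x2: "\<psi> x \<in> filt 2" and e2: "\<psi> (e 1) \<in> filt 2" using p q C by simp_all

  \<comment> \<open>With \<xi> = 0 the shift term in \<open>key\<close> is gone and the right side
    lies in the line of \<open>e (2*n)\<close>; all weights before \<open>2*n\<close> differ from
    2.\<close>
  have G: "\<psi> (bas j) \<in> filt (2*n)" if "2 \<le> j" "j < 2*n" for j
    using that(2,1)
  proof (induction j rule: measure_induct_rule[of "\<lambda>j. 2*n - j"])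
    case (less j)
    have *: "\<psi> (br (bas j) x - bas j) \<in> filt (2*n)"
      by (rule \<psi>filt[OF g]) (use less in auto)
    have W: "br (bas j) p \<in> filt (2*n)" using br_bas_filt[OF p(1)] less.prems by simp
    have "scale 2 (\<psi> (bas j)) - br (\<psi> (bas j)) x \<in> filt (2*n)"
      unfolding key using C
      by (auto intro!: filt_diff filt_scale W *)
    then show ?case by (rule filt_of_br_x[OF filt_0]) (auto simp: weight_def)
  qed

  \<comment> \<open>In \<open>2 \<psi> (e i) = [\<psi> (e (i-1)), e 1] +
    [e (i-1), \<psi> (e 1)]\<close> the first bracket is a multiple of
    \<open>[e (2*n), e 1] = 0\<close>. The second vanishes because \<open>(i - 1) + m\<close>
    exceeds \<open>2*n + 1\<close>.\<close>
  have tail: "\<psi> (bas i) = 0" if m: "\<psi> (e 1) \<in> filt m" "2 \<le> m" "3 \<le> i" "i < 2*n" "2*n + 2 < i + m" for i m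
  proof -
    have "br (\<psi> (bas (i - 1))) (e 1) \<in> filt (Suc (2*n))"
      by (rule br_e1_filt[OF G]) (use m n3 in auto)
    then have "br (\<psi> (bas (i - 1))) (e 1) = 0" by (rule filt_top_zero)
    moreover have "br (bas (i - 1)) (\<psi> (e 1)) = 0"
      by (rule br_bas_filt_zero[OF m(1)]) (use m in auto)
    ultimately have "scale 2 (\<psi> (bas i)) = 0"
      using D[of "bas (i - 1)" "e 1"] br_bas_e1[of "i - 1"] m by simp
    then show ?thesis by simp
  qed

  have xm: "\<psi> x \<in> filt m" if m: "\<psi> (e 1) \<in> filt m" "2 \<le> m" "m \<le> 2*n" for m
  proof -
    have "\<psi> x \<in> filt k" if "2 \<le> k" "k \<le> m" for k
      using that
    proof (induction k rule: dec_induct)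
      case base
      then show ?case using x2 by simp
    next
      case (step k)
      \<comment> \<open>The partner of \<open>bas k\<close> tests coordinate \<open>k\<close> of
        \<psi> x. Since \<open>k < m\<close>, all indices beyond \<open>?j\<close> fall under
        \<open>tail\<close>, so the last term of \<open>key\<close> is zero. The left side is zero
        as well, because \<open>\<psi> (bas ?j)\<close> is a multiple of \<open>e (2*n)\<close>, on
        which \<open>R\<close> is 2.\<close>
      let ?j = "2*n + 1 - k"
      have j: "2 \<le> ?j" "?j < 2*n" using step m by auto
      have "\<psi> (br (bas ?j) x - bas ?j) \<in> filt (Suc (2*n))"
        by (rule \<psi>filt[OF g[OF j]]) (use tail[OF m(1)] step m in auto)
      then have z: "\<psi> (br (bas ?j) x - bas ?j) = 0" by (rule filt_top_zero)
      have pe: "\<psi> (bas ?j) = scale (coord (2*n) (\<psi> (bas ?j))) (bas (2*n))" using filt_2n[OF G[OF j]] .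
      have "br (bas (2*n)) x = scale 2 (bas (2*n))" using br_e2n_x n3 by (simp add: bas_def)
      then have "br (\<psi> (bas ?j)) x = scale 2 (\<psi> (bas ?j))"
        by (subst (1 2) pe) (simp add: br_scale_left mult.commute)
      then have "br (bas ?j) (\<psi> x) = 0" using key[of ?j] z C p by simp
      then have "coord k (\<psi> x) = 0"
        by (rule coord_zero_of_br_bas[rotated -1]) (use step m in auto)
      then show ?case using step by (simp add: filt_Suc)
    qed
    then show ?thesis using m by blast
  qed

  have R1: "br (\<psi> (e 1)) x = br (\<psi> x) (e 1)"
    using D[of "e 1" x] br_e1_x br_swap[of "e 1" "\<psi> x"] by (simp add: L.zero)
  \<comment> \<open>By \<open>xm\<close>, \<psi> x is as deep as \<open>\<psi> (e 1)\<close>, and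
    bracketing with \<open>e 1\<close> gains one level. As \<open>R\<close> has no weight 0 from
    position 2 on, \<open>R1\<close> passes this gain to \<open>\<psi> (e 1)\<close>.\<close>
  have step: "\<psi> (e 1) \<in> filt (Suc m)" if "\<psi> (e 1) \<in> filt m" "2 \<le> m" "m \<le> 2*n" for m
  proof (rule filt_of_br_x[of _ 2 0])
    show "scale 0 (\<psi> (e 1)) - br (\<psi> (e 1)) x \<in> filt (Suc m)"
      using br_e1_filt[OF xm[OF that]] that R1 by (simp add: filt_uminus)
  qed (use that e2 in \<open>auto simp: weight_def\<close>)
  have all: "\<psi> (e 1) \<in> filt m" if "2 \<le> m" "m \<le> Suc (2*n)" for m
    using that by (induction m rule: dec_induct) (use e2 step in auto)
  show z: "\<psi> (e 1) = 0" using all[of "Suc (2*n)"] n3 by (auto intro: filt_top_zero)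
  show "\<psi> x \<in> filt (2*n)" using xm[of "2*n"] z n3 by simp
  show "\<psi> (e 2) \<in> filt (2*n)" using G[of 2] n3 by (simp add: bas_def)
  show "\<psi> (e i) = 0" if "3 \<le> i" "i \<le> 2*n" for i
    using tail[of "2*n" i] top z that n3 by (cases "i = 2*n") (auto simp: bas_def)
qed

end

section \<open>Reduction of an arbitrary half-derivation to the normalised case\<close>

theorem theorem2p7:
  fixes scale :: "complex \<Rightarrow> 'v::ab_group_add \<Rightarrow> 'v"
    and br :: "'v \<Rightarrow> 'v \<Rightarrow> 'v"
    and n :: nat and lam :: "nat \<Rightarrow> complex"
    and e :: "nat \<Rightarrow> 'v" and x :: 'v
    and \<phi> :: "'v \<Rightarrow> 'v"
  assumes "n \<ge> 3"
    and "r_algebra scale br n lam e x"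
    and "half_derivation scale br \<phi>"
  shows "\<exists>a b c :: complex.
    (\<forall>i. 1 \<le> i \<and> i \<le> 2*n \<and> i \<noteq> 2 \<longrightarrow> \<phi> (e i) = scale a (e i)) \<and>
    \<phi> (e 2) = scale a (e 2) + scale b (e (2*n)) \<and>
    \<phi> x = scale c (e (2*n)) + scale a x"
proof -
  interpret r_algebra scale br n lam e x by (rule assms(2))
  interpret r_algebra_ge_3 scale br n lam e x by unfold_locales (rule assms(1))
  \<comment> \<open>Subtracting \<open>a\<close> times the identity removes the
    \<open>x\<close>-coordinate of the image of \<open>x\<close>. The witnesses for \<open>b\<close>
    and \<open>c\<close> are then the \<open>e (2*n)\<close>-coordinates of the difference at
    \<open>e 2\<close> and at \<open>x\<close>.\<close>
  define a where "a = coord 0 (\<phi> x)"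
  let ?\<psi> = "\<lambda>v. \<phi> v - scale a v"
  have "coord 0 (?\<psi> x) = 0"
    using coord_bas[of 0 0] by (simp add: coord_diff coord_scale a_def bas_def)
  note N = normalized_half_derivation[OF half_derivation_diff_scale[OF assms(3)] this]
  have bas_2n: "bas (2*n) = e (2*n)" using assms(1) by (simp add: bas_def)
  have "\<phi> (e i) = scale a (e i)" if "1 \<le> i" "i \<le> 2*n" "i \<noteq> 2" for i
    using N(1) N(2)[of i] that by (cases "i = 1") auto
  moreover have "\<phi> (e 2) = scale a (e 2) + scale (coord (2*n) (?\<psi> (e 2))) (e (2*n))"
    using filt_2n[OF N(3)] by (simp add: bas_2n diff_eq_eq add.commute)
  moreover have "\<phi> x = scale (coord (2*n) (?\<psi> x)) (e (2*n)) + scale a x"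
    using filt_2n[OF N(4)] by (simp add: bas_2n diff_eq_eq add.commute)
  ultimately show ?thesis by blast
qed

end
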